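(* Let $T$ be a tree on $n$ vertices with maximum degree $\Delta$. Then $H(T)\ge H(B_{n,\Delta})$, with equality if and only if $T\cong B_{n,\Delta}$.
   Context: The Harary index of a connected graph $G$ is $H(G)=\sum_{\{x,y\}\subseteq V(G),\,x\ne y}\frac{1}{d(x,y)}$, $d$ the shortest-path distance. The broom $B_{n,\Delta}$ is the tree on $n$ vertices consisting of a star $S_{\Delta+1}$ and a path of length $n-\Delta-1$ attached at one pendent vertex of the star. *)

theory Defs
  imports "Graph_Theory.Graph_Theory"
begin

text \<open>
  A finite simple graph is a \<^locale>\<open>pair_graph\<close>: a finite vertex set together with a
  symmetric, irreflexive set of arcs, so that an undirected edge is a pair of opposite arcs.

  The library constant \<^const>\<open>tree\<close> cannot be used for such graphs: an arc followed by its
  reverse is a \<^const>\<open>pre_digraph.cycle\<close>.  These are the only cycles of length less than 3 in a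
  loop-free graph without parallel arcs, and the longer ones are exactly the cycles in the
  undirected sense.
\<close>

definition undirected_tree :: "'a pair_pre_digraph \<Rightarrow> bool" where
  "undirected_tree G \<longleftrightarrow>
     pair_graph G \<and> connected (with_proj G) \<and>
     (\<nexists>p. pre_digraph.cycle (with_proj G) p \<and> 3 \<le> length p)"

text \<open>Every edge at a vertex contributes exactly one outgoing arc.\<close>

definition max_degree :: "'a pair_pre_digraph \<Rightarrow> nat" where
  "max_degree G = Max (out_degree (with_proj G) ` pverts G)"

definition graph_dist :: "'a pair_pre_digraph \<Rightarrow> 'a \<Rightarrow> 'a \<Rightarrow> real" where
  "graph_dist G u v = real_of_ereal (wf_digraph.\<mu> (with_proj G) (\<lambda>_. 1) u v)"

text \<open>The distance of an unordered pair; well defined by symmetry, see below.\<close>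

definition pair_dist :: "'a pair_pre_digraph \<Rightarrow> 'a set \<Rightarrow> real" where
  "pair_dist G P = (THE d. \<exists>x y. P = {x, y} \<and> x \<noteq> y \<and> d = graph_dist G x y)"

definition harary_index :: "'a pair_pre_digraph \<Rightarrow> real" where
  "harary_index G = (\<Sum>P | P \<subseteq> pverts G \<and> card P = 2. 1 / pair_dist G P)"

text \<open>
  The star has centre \<open>0\<close> and pendent vertices \<open>1, \<dots>, \<Delta>\<close>; the path
  \<open>\<Delta>, \<Delta> + 1, \<dots>, n - 1\<close>, of length \<open>n - \<Delta> - 1\<close>, starts at the pendent vertex \<open>\<Delta>\<close>.
  This is meant for \<open>\<Delta> < n\<close>.  For \<open>n = 1\<close> and \<open>\<Delta> = 0\<close> it is the one-vertex graph.
\<close>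

definition broom :: "nat \<Rightarrow> nat \<Rightarrow> nat pair_pre_digraph" where
  "broom n \<Delta> =
     \<lparr> pverts = {..<n},
       parcs = symcl ({(0, i) | i. 1 \<le> i \<and> i \<le> \<Delta>} \<union> {(i, i + 1) | i. \<Delta> \<le> i \<and> i + 1 < n}) \<rparr>"

lemma pair_graph_broom:
  assumes "\<Delta> < n"
  shows "pair_graph (broom n \<Delta>)"
proof -
  have fin: "finite (parcs (broom n \<Delta>))"
    by (rule finite_subset[of _ "{..<n} \<times> {..<n}"])
      (use assms in \<open>auto simp: broom_def symcl_def\<close>)
  show ?thesis
    by unfold_locales
      (use assms fin in \<open>auto simp: broom_def symcl_def symmetric_def sym_def\<close>)
qed

lemma graph_dist_commute:
  assumes "pair_graph G"
  shows "graph_dist G u v = graph_dist G v u"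
proof -
  interpret pair_graph G by fact
  have cost: "awalk_cost (\<lambda>_. 1) p = real (length p)" for p
    by (induction p) auto
  have sub: "awalk_cost (\<lambda>_. 1) ` {p. awalk x p y} \<subseteq> awalk_cost (\<lambda>_. 1) ` {p. awalk y p x}" for x y
  proof safe
    fix p assume "awalk x p y"
    then have "awalk y (rev_path p) x" by simp
    moreover have "length (rev_path p) = length p" by (induction p) auto
    ultimately show "awalk_cost (\<lambda>_. 1) p \<in> awalk_cost (\<lambda>_. 1) ` {p. awalk y p x}"
      by (intro image_eqI[of _ _ "rev_path p"]) (auto simp: cost)
  qed
  have "ereal ` awalk_cost (\<lambda>_. 1) ` {p. awalk u p v} = ereal ` awalk_cost (\<lambda>_. 1) ` {p. awalk v p u}"
    by (rule arg_cong[OF subset_antisym[OF sub sub]])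
  then have "\<mu> (\<lambda>_. 1) u v = \<mu> (\<lambda>_. 1) v u"
    unfolding \<mu>_def by (simp only: image_image)
  then show ?thesis by (simp add: graph_dist_def)
qed

lemma pair_dist_eq:
  assumes "pair_graph G" "x \<noteq> y"
  shows "pair_dist G {x, y} = graph_dist G x y"
  unfolding pair_dist_def
  by (rule the_equality)
    (use assms graph_dist_commute[OF assms(1)] in \<open>auto simp: doubleton_eq_iff\<close>)

end

theory Submission
  imports Defs
begin

text \<open>
  Let \<open>v\<close> have degree \<open>\<Delta> \<ge> 2\<close> and let \<open>w\<close> be a vertex farthest from \<open>v\<close>. If \<open>w\<close> is not adjacent to
  \<open>v\<close>, removing the leaf \<open>w\<close> leaves a tree in which \<open>v\<close> still has degree \<open>\<Delta>\<close>, and lowers the index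
  by the sum of the reciprocal distances from \<open>w\<close>. Every distance from \<open>1\<close> to the eccentricity of
  \<open>w\<close> occurs, and the eccentricity is at most \<open>m = n - \<Delta> + 1\<close>, because \<open>\<Delta> - 1\<close> neighbours of \<open>v\<close>
  share one distance. Hence that sum is at least \<open>1/1 + \<dots> + 1/m + (\<Delta> - 2)/m\<close>, which is its value
  at the end of the path of the broom. Equality forces the layers around \<open>w\<close> to have sizes
  \<open>1, \<dots>, 1, \<Delta> - 1\<close>, and in a tree these sizes already determine the broom. The induction ends at
  the star, where \<open>n = \<Delta> + 1\<close>.
\<close>

section \<open>Sums of reciprocals\<close>

text \<open>The diagonal contributes nothing, since \<open>1 / 0 = 0\<close>; hence this is twice the Harary index.\<close>

definition recip_sum :: "'a set \<Rightarrow> ('a \<Rightarrow> 'a \<Rightarrow> nat) \<Rightarrow> real" where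
  "recip_sum V d = (\<Sum>x\<in>V. \<Sum>y\<in>V. 1 / real (d x y))"

lemma recip_sum_insert:
  assumes "finite V" "w \<notin> V" "d w w = 0" "\<And>x. x \<in> V \<Longrightarrow> d x w = d w x"
  shows "recip_sum (insert w V) d = recip_sum V d + 2 * (\<Sum>u\<in>V. 1 / real (d w u))"
  using assms by (simp add: recip_sum_def sum.distrib)

text \<open>The bridge from the sum over two-element sets in \<open>harary_index\<close> to a double
  sum, which is easier to split and reindex. By induction on \<open>V\<close>: a new vertex
  \<open>w\<close> adds exactly the pairs \<open>{w, u}\<close>.\<close>

lemma sum_pairs_eq_recip_sum:
  fixes h :: "'a set \<Rightarrow> real"
  assumes "finite V" "\<And>x. x \<in> V \<Longrightarrow> d x x = 0"
    "\<And>x y. x \<in> V \<Longrightarrow> y \<in> V \<Longrightarrow> d x y = d y x"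
    "\<And>x y. x \<in> V \<Longrightarrow> y \<in> V \<Longrightarrow> x \<noteq> y \<Longrightarrow> h {x, y} = 1 / real (d x y)"
  shows "(\<Sum>P | P \<subseteq> V \<and> card P = 2. h P) = recip_sum V d / 2"
  using assms
proof (induction V)
  case empty
  have "{P. P \<subseteq> {} \<and> card P = 2} = ({} :: 'a set set)" by auto
  then show ?case unfolding recip_sum_def by (simp only: sum.empty)
next
  case (insert w V)
  have split: "{P. P \<subseteq> insert w V \<and> card P = 2} = {P. P \<subseteq> V \<and> card P = 2} \<union> (\<lambda>u. {w, u}) ` V"
    using insert.hyps by (auto simp: card_2_iff)
  have inj: "inj_on (\<lambda>u. {w, u}) V"
    by (auto simp: inj_on_def doubleton_eq_iff)
  have h_eq: "h {w, u} = 1 / real (d w u)" if "u \<in> V" for u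
    using insert.prems(3)[of w u] insert.hyps that by auto
  have "(\<Sum>P | P \<subseteq> insert w V \<and> card P = 2. h P)
      = (\<Sum>P | P \<subseteq> V \<and> card P = 2. h P) + (\<Sum>P\<in>(\<lambda>u. {w, u}) ` V. h P)"
    unfolding split using insert.hyps by (intro sum.union_disjoint) auto
  also have "(\<Sum>P | P \<subseteq> V \<and> card P = 2. h P) = recip_sum V d / 2"
    using insert.prems by (intro insert.IH) auto
  also have "(\<Sum>P\<in>(\<lambda>u. {w, u}) ` V. h P) = (\<Sum>u\<in>V. 1 / real (d w u))"
    unfolding sum.reindex[OF inj] by (intro sum.cong) (auto simp: h_eq)
  also have "recip_sum V d / 2 + (\<Sum>u\<in>V. 1 / real (d w u)) = recip_sum (insert w V) d / 2"
    using insert.hyps insert.prems by (subst recip_sum_insert) auto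
  finally show ?case .
qed

lemma recip_sum_reindex:
  assumes "bij_betw f V V'" "\<And>x y. x \<in> V \<Longrightarrow> y \<in> V \<Longrightarrow> d x y = d' (f x) (f y)"
  shows "recip_sum V d = recip_sum V' d'"
proof -
  have "recip_sum V d = (\<Sum>x\<in>V. \<Sum>y\<in>V. 1 / real (d' (f x) (f y)))"
    unfolding recip_sum_def using assms(2) by (intro sum.cong) auto
  also have "\<dots> = (\<Sum>x\<in>V. \<Sum>y\<in>V'. 1 / real (d' (f x) y))"
    by (rule sum.cong[OF refl]) (rule sum.reindex_bij_betw[OF assms(1)])
  also have "\<dots> = recip_sum V' d'"
    unfolding recip_sum_def by (rule sum.reindex_bij_betw[OF assms(1)])
  finally show ?thesis .
qed

text \<open>Keep one element for each value from \<open>1\<close> to \<open>e\<close>; each of the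
  \<open>card A - e\<close> others contributes at least \<open>1 / e\<close>. Beyond its first
  \<open>e\<close> terms, \<open>b\<close> also consists of \<open>card A - e\<close> terms, each at
  most \<open>1 / e\<close>.\<close>

lemma reciprocal_sum_layers:
  fixes f :: "'a \<Rightarrow> nat"
  assumes A: "finite A" "f ` A = {1..e}" and e: "e \<le> m" "m \<le> card A" "0 < card A"
  defines "b \<equiv> (\<Sum>i=1..m. 1 / real i) + real (card A - m) / real m"
  shows "b \<le> (\<Sum>a\<in>A. 1 / real (f a))"
    and "(\<Sum>a\<in>A. 1 / real (f a)) = b \<Longrightarrow> e = m \<and> inj_on f {a \<in> A. f a < m}"
proof -
  obtain R where R: "R \<subseteq> A" "inj_on f R" "f ` R = {1..e}"
    using A(2) by (metis subset_image_inj order_refl)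
  have "e > 0" using A e(3) by (metis atLeastatMost_empty card_gt_0_iff image_is_empty
        neq0_conv zero_less_one)
  have fle: "f a \<le> e" "0 < f a" if "a \<in> A" for a
    using that A(2) by (metis atLeastAtMost_iff imageI, metis atLeastAtMost_iff imageI less_eq_Suc_le One_nat_def)
  have cR: "card R = e" using R card_image by fastforce
  have cAR: "card (A - R) = card A - e"
    using R A by (simp add: card_Diff_subset finite_subset cR)
  have "(\<Sum>a\<in>A. 1 / real (f a)) = (\<Sum>a\<in>A-R. 1 / real (f a)) + (\<Sum>a\<in>R. 1 / real (f a))"
    using R A by (intro sum.subset_diff) auto
  also have "(\<Sum>a\<in>R. 1 / real (f a)) = (\<Sum>i=1..e. 1 / real i)"
    using sum.reindex[OF R(2), of "\<lambda>i. 1 / real i"] R(3) by simp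
  finally have tot: "(\<Sum>a\<in>A. 1 / real (f a)) = (\<Sum>a\<in>A-R. 1 / real (f a)) + (\<Sum>i=1..e. 1 / real i)" .
  have "{1..m} = {1..e} \<union> {e<..m}" "{1..e} \<inter> {e<..m} = {}" using e \<open>e > 0\<close> by auto
  then have Hm: "(\<Sum>i=1..m. 1 / real i) = (\<Sum>i=1..e. 1 / real i) + (\<Sum>i\<in>{e<..m}. 1 / real i)"
    by (simp add: sum.union_disjoint)
  have rest: "real (card A - e) / real e \<le> (\<Sum>a\<in>A-R. 1 / real (f a))"
  proof -
    have "real (card A - e) / real e = (\<Sum>a\<in>A-R. 1 / real e)" by (simp add: cAR)
    also have "\<dots> \<le> (\<Sum>a\<in>A-R. 1 / real (f a))"
      using fle by (intro sum_mono) (auto simp: frac_le)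
    finally show ?thesis .
  qed
  have mid: "(\<Sum>i\<in>{e<..m}. 1 / real i) \<le> real (m - e) / real e"
  proof -
    have "(\<Sum>i\<in>{e<..m}. 1 / real i) \<le> (\<Sum>i\<in>{e<..m}. 1 / real e)"
      using \<open>e > 0\<close> by (intro sum_mono) (auto simp: frac_le)
    then show ?thesis by simp
  qed
  \<comment> \<open>Strictness here is what forces \<open>e = m\<close> in the equality
    case.\<close>
  have mid_less: "(\<Sum>i\<in>{e<..m}. 1 / real i) < real (m - e) / real e" if "e < m"
  proof -
    have "(\<Sum>i\<in>{e<..m}. 1 / real i) < (\<Sum>i\<in>{e<..m}. 1 / real e)"
      using \<open>e > 0\<close> that by (intro sum_strict_mono) (auto simp: frac_less2)
    then show ?thesis by simp
  qed
  have last: "real (card A - m) / real m \<le> real (card A - m) / real e"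
    using e \<open>e > 0\<close> by (intro divide_left_mono) auto
  have add: "real (m - e) / real e + real (card A - m) / real e = real (card A - e) / real e"
    using e by (simp add: add_divide_distrib[symmetric])
  show "b \<le> (\<Sum>a\<in>A. 1 / real (f a))"
    unfolding b_def tot Hm using rest mid last add by linarith
  assume eq: "(\<Sum>a\<in>A. 1 / real (f a)) = b"
  have em: "e = m"
  proof (rule ccontr)
    assume "e \<noteq> m"
    then show False
      using mid_less e eq rest last add unfolding b_def tot Hm by simp
  qed
  \<comment> \<open>The excesses over \<open>1 / m\<close> are nonnegative and sum to zero, so every
    element outside the transversal \<open>R\<close> has value \<open>m\<close>.\<close>
  have "(\<Sum>a\<in>A-R. 1 / real (f a) - 1 / real m) = 0"
    using eq by (simp add: b_def tot em sum_subtractf cAR)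
  moreover have "0 \<le> 1 / real (f a) - 1 / real m" if "a \<in> A - R" for a
    using that fle em by (simp add: frac_le)
  ultimately have "1 / real (f a) - 1 / real m = 0" if "a \<in> A - R" for a
    using that sum_nonneg_eq_0_iff[of "A - R" "\<lambda>a. 1 / real (f a) - 1 / real m"] A by auto
  then have "f a = m" if "a \<in> A - R" for a
    using that by force
  then have "{a \<in> A. f a < m} \<subseteq> R" by auto
  then show "e = m \<and> inj_on f {a \<in> A. f a < m}"
    using em inj_on_subset[OF R(2)] by auto
qed

section \<open>Tree metrics\<close>

text \<open>
  The distance of a tree, restricted to a connected vertex set. The last assumption replaces
  acyclicity and is inherited by subsets.
\<close>

locale tree_metric =
  fixes V :: "'a set" and d :: "'a \<Rightarrow> 'a \<Rightarrow> nat"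
  assumes finite_V: "finite V"
    and dist_eq_0: "x \<in> V \<Longrightarrow> y \<in> V \<Longrightarrow> d x y = 0 \<longleftrightarrow> x = y"
    and dist_commute: "x \<in> V \<Longrightarrow> y \<in> V \<Longrightarrow> d x y = d y x"
    and dist_triangle: "x \<in> V \<Longrightarrow> y \<in> V \<Longrightarrow> z \<in> V \<Longrightarrow> d x z \<le> d x y + d y z"
    and ex_step: "x \<in> V \<Longrightarrow> y \<in> V \<Longrightarrow> x \<noteq> y \<Longrightarrow> \<exists>z\<in>V. d x z = 1 \<and> d x y = Suc (d z y)"
    and step_unique: "\<lbrakk>x \<in> V; y \<in> V; z \<in> V; z' \<in> V; d x z = 1; d x z' = 1; d z y \<le> d x y; d z' y \<le> d x y\<rbrakk>
      \<Longrightarrow> z = z'"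
begin

lemma dist_self: "x \<in> V \<Longrightarrow> d x x = 0"
  using dist_eq_0 by blast

text \<open>Trees are bipartite: at equal distances, \<open>y\<close> would be a second neighbour of
  \<open>x\<close> not farther from \<open>v\<close>, besides the one on the way to
  \<open>v\<close>.\<close>

lemma adjacent_dist_neq:
  assumes "x \<in> V" "y \<in> V" "v \<in> V" "d x y = 1"
  shows "d x v \<noteq> d y v"
proof
  assume eq: "d x v = d y v"
  have "x \<noteq> v" using eq assms dist_self[of x] dist_eq_0[of y x] by auto
  then obtain z where z: "z \<in> V" "d x z = 1" "d x v = Suc (d z v)" using ex_step assms by blast
  then have "z = y" using assms eq by (intro step_unique[of x v]) auto
  then show False using z eq by simp
qed

lemma adjacent_dist_cases:
  assumes "x \<in> V" "y \<in> V" "v \<in> V" "d x y = 1"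
  shows "d x v = Suc (d y v) \<or> d y v = Suc (d x v)"
  using adjacent_dist_neq[OF assms] dist_triangle[of x y v] dist_triangle[of y x v] assms
    dist_commute[of x y] by linarith

text \<open>Stepping from \<open>u\<close> towards \<open>w\<close> lowers the distance to
  \<open>w\<close> by one at a time, so no value is skipped.\<close>

lemma dist_surj:
  assumes "w \<in> V" "k \<le> d w u" "u \<in> V"
  shows "\<exists>z\<in>V. d w z = k"
  using assms
proof (induction "d w u" arbitrary: u)
  case 0
  then show ?case by auto
next
  case (Suc j)
  then have "u \<noteq> w" using dist_self by force
  then obtain z where z: "z \<in> V" "d u w = Suc (d z w)" using ex_step Suc.prems by blast
  then have "d w z = j" using Suc.hyps Suc.prems dist_commute by force
  then show ?case using Suc z by (cases "k = Suc j") auto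
qed

text \<open>Only \<open>ex_step\<close> is at stake. If a step from \<open>x\<close> towards
  \<open>y\<close> led to \<open>w\<close>, then \<open>x\<close> and the vertex after
  \<open>w\<close> would both be neighbours of \<open>w\<close> no farther from \<open>v\<close>
  than \<open>w\<close>, hence equal by \<open>step_unique\<close>: a farthest vertex is a
  leaf.\<close>

lemma remove_farthest:
  assumes "v \<in> V" "w \<in> V" "v \<noteq> w" and far: "\<And>u. u \<in> V \<Longrightarrow> d v u \<le> d v w"
  shows "tree_metric (V - {w}) d"
proof
  fix x y assume xy: "x \<in> V - {w}" "y \<in> V - {w}" "x \<noteq> y"
  then obtain z where z: "z \<in> V" "d x z = 1" "d x y = Suc (d z y)" using ex_step by blast
  have "z \<noteq> w"
  proof
    assume "z = w"
    then obtain z' where z': "z' \<in> V" "d w z' = 1" "d w y = Suc (d z' y)"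
      using ex_step assms xy by (metis DiffE insertI1)
    have "d x v \<le> d w v" "d z' v \<le> d w v"
      using far[of x] far[of z'] xy z' assms dist_commute[of v] by auto
    then have "x = z'"
      using z z' xy assms \<open>z = w\<close> dist_commute[of x w] by (intro step_unique[of w v]) auto
    then show False using z z' \<open>z = w\<close> by simp
  qed
  then show "\<exists>z\<in>V - {w}. d x z = 1 \<and> d x y = Suc (d z y)" using z by auto
next
  show "finite (V - {w})" using finite_V by simp
next
  fix x y z z'
  assume "x \<in> V - {w}" "y \<in> V - {w}" "z \<in> V - {w}" "z' \<in> V - {w}"
    "d x z = 1" "d x z' = 1" "d z y \<le> d x y" "d z' y \<le> d x y"
  then show "z = z'" by (intro step_unique[of x y]) auto
qed (simp_all add: dist_eq_0 dist_triangle dist_commute)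

text \<open>Every vertex except \<open>w\<close> has a neighbour one layer closer to
  \<open>w\<close>, and a layer below \<open>m\<close> has only one vertex, so that vertex is the
  neighbour. Thus the layers around \<open>w\<close> determine the graph.\<close>

lemma adjacent_iff_layers:
  assumes "w \<in> V" "\<And>x. x \<in> V \<Longrightarrow> d w x \<le> m" "inj_on (d w) {x \<in> V. d w x < m}" "x \<in> V" "y \<in> V"
  shows "d x y = 1 \<longleftrightarrow> d w x = Suc (d w y) \<or> d w y = Suc (d w x)"
proof -
  have *: "d a b = 1" if ab: "a \<in> V" "b \<in> V" "d w a = Suc (d w b)" for a b
  proof -
    have "a \<noteq> w" using ab dist_self by force
    then obtain z where z: "z \<in> V" "d a z = 1" "d a w = Suc (d z w)" using ex_step ab assms(1) by blast
    then have "d w z = d w b" using ab assms(1) dist_commute by force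
    moreover have "d w b < m" using ab assms(2) by force
    ultimately have "z = b" using assms(3) z(1) ab(2) by (auto dest: inj_onD)
    then show ?thesis using z by simp
  qed
  show ?thesis
    using adjacent_dist_cases[of x y w] *[of x y] *[of y x] dist_commute assms by metis
qed

text \<open>
  All neighbours of \<open>v\<close> but one lie at distance \<open>d w v + 1\<close> from \<open>w\<close>, while every distance from
  \<open>1\<close> to the eccentricity of \<open>w\<close> occurs; this bounds the eccentricity by \<open>m\<close>.
\<close>

lemma transmission_lower_bound:
  fixes v w :: 'a
  defines "m \<equiv> card V + 1 - card {u \<in> V. d v u = 1}"
  defines "b \<equiv> (\<Sum>i=1..m. 1 / real i) + real (card {u \<in> V. d v u = 1} - 2) / real m"
  assumes vw: "v \<in> V" "w \<in> V" "v \<noteq> w" and deg: "2 \<le> card {u \<in> V. d v u = 1}"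
  shows "b \<le> (\<Sum>u\<in>V - {w}. 1 / real (d w u))"
    and "(\<Sum>u\<in>V - {w}. 1 / real (d w u)) = b \<Longrightarrow>
      d w ` V = {0..m} \<and> inj_on (d w) {u \<in> V. d w u < m}"
proof -
  let ?N = "{u \<in> V. d v u = 1}" and ?A = "V - {w}"
  define e where "e = Max (d w ` V)"
  have e_max: "d w u \<le> e" if "u \<in> V" for u using that finite_V by (simp add: e_def)
  have "e \<in> d w ` V" unfolding e_def using finite_V vw by (intro Max_in) auto
  then have ex: "\<exists>z\<in>V. d w z = k" if "k \<le> e" for k using dist_surj[OF vw(2)] that by force
  then have img: "d w ` V = {0..e}" using e_max by force
  have imgA: "d w ` ?A = {1..e}"
  proof (intro equalityI subsetI)
    fix k assume "k \<in> d w ` ?A"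
    then show "k \<in> {1..e}" using e_max dist_eq_0 vw by (auto simp: Suc_le_eq intro: gr0I)
  next
    fix k assume k: "k \<in> {1..e}"
    then obtain z where "z \<in> V" "d w z = k" using ex by auto
    then show "k \<in> d w ` ?A" using k vw dist_self by force
  qed
  obtain p where p: "p \<in> V" "d v p = 1" "d v w = Suc (d p w)" using ex_step vw by blast
  \<comment> \<open>By \<open>step_unique\<close>, \<open>p\<close> is the only neighbour of
    \<open>v\<close> not farther from \<open>w\<close> than \<open>v\<close>.\<close>
  have nbr: "d w u = Suc (d w v)" if "u \<in> ?N" "u \<noteq> p" for u
  proof -
    have "\<not> d u w \<le> d v w" using that p vw step_unique[of v w u p] by auto
    then have "d u w = Suc (d v w)" using adjacent_dist_cases[of v u w] that vw by auto
    then show ?thesis using dist_commute vw that by force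
  qed
  have pN: "p \<in> ?N" using p by auto
  then have cN: "card (?N - {p}) = card ?N - 1" by simp
  then have "card (?N - {p}) \<noteq> 0" using deg by linarith
  then have "?N - {p} \<noteq> {}" by (metis card.empty)
  then obtain u where "u \<in> ?N - {p}" by blast
  then have De: "Suc (d w v) \<le> e" using nbr e_max by fastforce
  \<comment> \<open>\<open>R\<close> has one representative per layer. The neighbours of
    \<open>v\<close> other than \<open>p\<close> all lie in the layer of \<open>r\<close>, so they
    are disjoint from \<open>R - {r}\<close>; counting both sets inside \<open>V - {w}\<close> gives
    \<open>e \<le> m\<close>.\<close>
  obtain R where R: "R \<subseteq> ?A" "inj_on (d w) R" "d w ` R = {1..e}"
    using imgA by (metis subset_image_inj order_refl)
  have finR: "finite R" using R(1) finite_V finite_subset by blast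
  have cR: "card R = e" using R card_image by fastforce
  obtain r where r: "r \<in> R" "d w r = Suc (d w v)" using R(3) De by force
  have disj: "(R - {r}) \<inter> (?N - {p}) = {}"
  proof -
    have "x = r" if "x \<in> R" "x \<in> ?N - {p}" for x
      using that nbr[of x] r by (intro inj_onD[OF R(2)]) auto
    then show ?thesis by blast
  qed
  have "w \<notin> ?N - {p}" using nbr vw dist_self by force
  then have "(R - {r}) \<union> (?N - {p}) \<subseteq> ?A" using R by blast
  then have "card ((R - {r}) \<union> (?N - {p})) \<le> card ?A" using finite_V by (intro card_mono) auto
  then have "(e - 1) + (card ?N - 1) \<le> card ?A"
    using card_Un_disjoint[OF _ _ disj] finR finite_V r cR cN by simp
  moreover have cA: "card ?A = card V - 1" using vw finite_V by simp
  moreover have "0 < card V" using vw finite_V card_gt_0_iff by blast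
  ultimately have em: "e \<le> m" and mA: "m \<le> card ?A" and Am: "card ?A - m = card ?N - 2"
    using De deg unfolding m_def by linarith+
  have posA: "0 < card ?A" using vw finite_V card_gt_0_iff by blast
  have finA: "finite ?A" using finite_V by simp
  note bound = reciprocal_sum_layers[OF finA imgA em mA posA, unfolded Am, folded b_def]
  show "b \<le> (\<Sum>u\<in>?A. 1 / real (d w u))" by (rule bound(1))
  assume "(\<Sum>u\<in>?A. 1 / real (d w u)) = b"
  then have e: "e = m" and inj: "inj_on (d w) {u \<in> ?A. d w u < m}" using bound(2) by auto
  have "inj_on (d w) {u \<in> V. d w u < m}"
  proof (rule inj_onI)
    fix x y assume xy: "x \<in> {u \<in> V. d w u < m}" "y \<in> {u \<in> V. d w u < m}" "d w x = d w y"
    show "x = y"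
    proof (cases "x = w \<or> y = w")
      case True
      then show ?thesis using xy vw dist_self[of w] dist_eq_0[of w x] dist_eq_0[of w y] by auto
    next
      case False
      then show ?thesis using xy inj by (auto dest: inj_onD)
    qed
  qed
  then show "d w ` V = {0..m} \<and> inj_on (d w) {u \<in> V. d w u < m}" using img e by simp
qed

end

section \<open>Brooms among tree metrics\<close>

text \<open>\<open>Suc a - \<Delta>\<close> is the position of \<open>a\<close> on the path \<open>0, \<Delta>, \<Delta> + 1, \<dots>\<close>; truncated subtraction
  gives position \<open>0\<close> to the centre and to the leaves \<open>1, \<dots>, \<Delta> - 1\<close>, and a leaf endpoint costs
  one more edge.\<close>

definition broom_dist :: "nat \<Rightarrow> nat \<Rightarrow> nat \<Rightarrow> nat" where
  "broom_dist \<Delta> a b = (if a = b then 0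
     else of_bool (0 < a \<and> a < \<Delta>) + of_bool (0 < b \<and> b < \<Delta>)
       + ((Suc a - \<Delta>) - (Suc b - \<Delta>)) + ((Suc b - \<Delta>) - (Suc a - \<Delta>)))"

text \<open>The distance to the end \<open>n - 1\<close> of the path.\<close>

definition broom_layer :: "nat \<Rightarrow> nat \<Rightarrow> nat \<Rightarrow> nat" where
  "broom_layer n \<Delta> a = (if a = 0 then n - \<Delta> else if a < \<Delta> then n - \<Delta> + 1 else n - 1 - a)"

lemma parcs_broom_iff:
  assumes "\<Delta> < n"
  shows "(a, b) \<in> parcs (broom n \<Delta>) \<longleftrightarrow> a < n \<and> b < n \<and>
    (a = 0 \<and> 1 \<le> b \<and> b \<le> \<Delta> \<or> b = 0 \<and> 1 \<le> a \<and> a \<le> \<Delta> \<or> \<Delta> \<le> a \<and> b = Suc a \<or> \<Delta> \<le> b \<and> a = Suc b)"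
  using assms by (auto simp: broom_def symcl_def)

text \<open>The counterpart of \<open>adjacent_iff_layers\<close> for the broom: once both graphs
  obey the same rule on layers, any layer-preserving bijection is an isomorphism.\<close>

lemma parcs_broom_iff_layers:
  assumes "2 \<le> \<Delta>" "\<Delta> < n" "a < n" "b < n"
  shows "(a, b) \<in> parcs (broom n \<Delta>) \<longleftrightarrow>
    broom_layer n \<Delta> a = Suc (broom_layer n \<Delta> b) \<or> broom_layer n \<Delta> b = Suc (broom_layer n \<Delta> a)"
  unfolding parcs_broom_iff[OF assms(2)] broom_layer_def using assms by auto

lemma parcs_star_broom_iff:
  assumes "a < Suc \<Delta>" "b < Suc \<Delta>"
  shows "(a, b) \<in> parcs (broom (Suc \<Delta>) \<Delta>) \<longleftrightarrow> a \<noteq> b \<and> (a = 0 \<or> b = 0)"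
  unfolding parcs_broom_iff[OF lessI] using assms by (cases a; cases b) auto

lemma broom_layer_image:
  assumes "2 \<le> \<Delta>" "\<Delta> < n"
  shows "broom_layer n \<Delta> ` {..<n} = {0..n + 1 - \<Delta>}"
    "inj_on (broom_layer n \<Delta>) {a \<in> {..<n}. broom_layer n \<Delta> a < n + 1 - \<Delta>}"
proof -
  have "k \<in> broom_layer n \<Delta> ` {..<n}" if "k \<le> n + 1 - \<Delta>" for k
  proof -
    \<comment> \<open>The centre sits in layer \<open>n - \<Delta>\<close> and the leaf
      \<open>1\<close>, present since \<open>\<Delta> \<ge> 2\<close>, in the last layer; the
      remaining layers are met on the path.\<close>
    have "k = broom_layer n \<Delta> (if k = n - \<Delta> then 0 else if k = n + 1 - \<Delta> then 1 else n - 1 - k)"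
      using assms that by (auto simp: broom_layer_def)
    moreover have "(if k = n - \<Delta> then 0 else if k = n + 1 - \<Delta> then 1 else n - 1 - k) \<in> {..<n}"
      using assms by auto
    ultimately show ?thesis by (rule image_eqI)
  qed
  moreover have "broom_layer n \<Delta> a \<le> n + 1 - \<Delta>" for a
    using assms by (auto simp: broom_layer_def)
  ultimately show "broom_layer n \<Delta> ` {..<n} = {0..n + 1 - \<Delta>}"
    by (meson atLeastAtMost_iff image_subsetI le0 subsetI subset_antisym)
  show "inj_on (broom_layer n \<Delta>) {a \<in> {..<n}. broom_layer n \<Delta> a < n + 1 - \<Delta>}"
    using assms by (auto simp: inj_on_def broom_layer_def split: if_splits)
qed

text \<open>\<open>broom_dist\<close> does not depend on the number of vertices, so the larger broom
  only gains the new path end \<open>n\<close>. Its distances are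
  \<open>1, ..., n - \<Delta>\<close> along the path, \<open>n - \<Delta> + 1\<close> to the centre
  and \<open>n - \<Delta> + 2\<close> to each of the \<open>\<Delta> - 1\<close> leaves.\<close>

lemma recip_sum_broom_Suc:
  assumes "2 \<le> \<Delta>" "\<Delta> < n"
  shows "recip_sum {..<Suc n} (broom_dist \<Delta>) = recip_sum {..<n} (broom_dist \<Delta>)
    + 2 * ((\<Sum>i=1..n + 2 - \<Delta>. 1 / real i) + real (\<Delta> - 2) / real (n + 2 - \<Delta>))"
proof -
  have "recip_sum {..<Suc n} (broom_dist \<Delta>) = recip_sum {..<n} (broom_dist \<Delta>)
      + 2 * (\<Sum>u<n. 1 / real (broom_dist \<Delta> n u))"
    unfolding lessThan_Suc by (rule recip_sum_insert) (auto simp: broom_dist_def)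
  moreover have "(\<Sum>u<n. 1 / real (broom_dist \<Delta> n u))
      = (\<Sum>i=1..n + 2 - \<Delta>. 1 / real i) + real (\<Delta> - 2) / real (n + 2 - \<Delta>)"
  proof -
    have s: "{..<n} = {\<Delta>..<n} \<union> {0} \<union> {1..<\<Delta>}" using assms by auto
    have "(\<Sum>u<n. 1 / real (broom_dist \<Delta> n u)) = (\<Sum>u\<in>{\<Delta>..<n}. 1 / real (broom_dist \<Delta> n u))
       + 1 / real (broom_dist \<Delta> n 0) + (\<Sum>u\<in>{1..<\<Delta>}. 1 / real (broom_dist \<Delta> n u))"
      unfolding s using assms by (subst sum.union_disjoint, auto)+
    also have "(\<Sum>u\<in>{\<Delta>..<n}. 1 / real (broom_dist \<Delta> n u)) = (\<Sum>i=1..n - \<Delta>. 1 / real i)"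
      using assms
      by (intro sum.reindex_bij_witness[of _ "\<lambda>i. n - i" "\<lambda>u. n - u"]) (auto simp: broom_dist_def)
    also have "(\<Sum>u\<in>{1..<\<Delta>}. 1 / real (broom_dist \<Delta> n u))
        = (\<Sum>u\<in>{1..<\<Delta>}. 1 / real (n + 2 - \<Delta>))"
      using assms by (intro sum.cong) (auto simp: broom_dist_def Suc_diff_le)
    also have "broom_dist \<Delta> n 0 = Suc (n - \<Delta>)"
      using assms by (auto simp: broom_dist_def)
    \<comment> \<open>One leaf supplies the last term of the harmonic sum, which leaves
      \<open>\<Delta> - 2\<close>.\<close>
    also have "(\<Sum>u\<in>{1..<\<Delta>}. 1 / real (n + 2 - \<Delta>))
        = 1 / real (n + 2 - \<Delta>) + real (\<Delta> - 2) / real (n + 2 - \<Delta>)"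
      using assms by (simp add: add_divide_distrib[symmetric] of_nat_diff)
    finally show ?thesis
      using assms by (simp add: Suc_diff_le numeral_2_eq_2 add.assoc)
  qed
  ultimately show ?thesis by simp
qed

text \<open>Below \<open>m\<close> both layer functions are bijections onto \<open>{0..<m}\<close>;
  the top layers then have equal size and may be matched arbitrarily.\<close>

lemma layered_bij:
  fixes f :: "'a \<Rightarrow> nat" and g :: "'b \<Rightarrow> nat"
  assumes "finite A" "finite B" "card A = card B" "f ` A = {0..m}" "g ` B = {0..m}"
    "inj_on f {a \<in> A. f a < m}" "inj_on g {b \<in> B. g b < m}"
  shows "\<exists>h. bij_betw h A B \<and> (\<forall>a\<in>A. g (h a) = f a)"
proof -
  have low: "\<exists>h. bij_betw h {a \<in> A. f a < m} {b \<in> B. g b < m} \<and> (\<forall>a\<in>{a \<in> A. f a < m}. g (h a) = f a)"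
  proof -
    have f: "bij_betw f {a \<in> A. f a < m} {0..<m}"
      using assms(4,6) by (force simp: bij_betw_def)
    have g: "bij_betw g {b \<in> B. g b < m} {0..<m}"
      using assms(5,7) by (force simp: bij_betw_def)
    note gi = bij_betw_inv_into[OF g]
    have "bij_betw (inv_into {b \<in> B. g b < m} g \<circ> f) {a \<in> A. f a < m} {b \<in> B. g b < m}"
      by (rule bij_betw_trans[OF f gi])
    moreover have "g (inv_into {b \<in> B. g b < m} g (f a)) = f a" if "a \<in> {a \<in> A. f a < m}" for a
      by (rule bij_betw_inv_into_right[OF g]) (use that bij_betwE[OF f] in blast)
    ultimately show ?thesis by (intro exI) auto
  qed
  then obtain h1 where h1: "bij_betw h1 {a \<in> A. f a < m} {b \<in> B. g b < m}"
    "\<And>a. a \<in> {a \<in> A. f a < m} \<Longrightarrow> g (h1 a) = f a" by blast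
  have top: "{a \<in> A. f a = m} = A - {a \<in> A. f a < m}" "{b \<in> B. g b = m} = B - {b \<in> B. g b < m}"
    using assms(4,5) by force+
  have "card {a \<in> A. f a = m} = card {b \<in> B. g b = m}"
    unfolding top using assms(1-3) bij_betw_same_card[OF h1(1)] by (simp add: card_Diff_subset)
  then obtain h2 where h2: "bij_betw h2 {a \<in> A. f a = m} {b \<in> B. g b = m}"
    using assms(1,2) finite_same_card_bij[of "{a \<in> A. f a = m}" "{b \<in> B. g b = m}"] by auto
  define h where "h a = (if f a < m then h1 a else h2 a)" for a
  have "bij_betw h {a \<in> A. f a < m} {b \<in> B. g b < m}"
    using h1(1) by (subst bij_betw_cong[of _ _ h1]) (auto simp: h_def)
  moreover have "bij_betw h {a \<in> A. f a = m} {b \<in> B. g b = m}"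
    using h2 by (subst bij_betw_cong[of _ _ h2]) (auto simp: h_def)
  ultimately have "bij_betw h ({a \<in> A. f a < m} \<union> {a \<in> A. f a = m}) ({b \<in> B. g b < m} \<union> {b \<in> B. g b = m})"
    by (rule bij_betw_combine) auto
  moreover have "{a \<in> A. f a < m} \<union> {a \<in> A. f a = m} = A" "{b \<in> B. g b < m} \<union> {b \<in> B. g b = m} = B"
    using top by auto
  moreover have "g (h a) = f a" if "a \<in> A" for a
  proof (cases "f a < m")
    case False
    then have "f a = m" using that top by blast
    then have "h2 a \<in> {b \<in> B. g b = m}" using h2 that bij_betwE by fastforce
    then show ?thesis using False \<open>f a = m\<close> by (simp add: h_def)
  qed (use h1 that in \<open>simp add: h_def\<close>)
  ultimately show ?thesis by metis
qed

text \<open>An isomorphism onto the broom, phrased through the metric so that the induction needs no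
  graph on \<open>V\<close>.\<close>

definition broom_labelling :: "'a set \<Rightarrow> ('a \<Rightarrow> 'a \<Rightarrow> nat) \<Rightarrow> nat \<Rightarrow> nat \<Rightarrow> ('a \<Rightarrow> nat) \<Rightarrow> bool" where
  "broom_labelling V d n \<Delta> f \<longleftrightarrow> bij_betw f V {..<n} \<and>
     (\<forall>x\<in>V. \<forall>y\<in>V. d x y = 1 \<longleftrightarrow> (f x, f y) \<in> parcs (broom n \<Delta>))"

section \<open>Minimality of the broom, starting from the star\<close>

context tree_metric
begin

text \<open>With \<open>\<Delta> + 1\<close> vertices in all, \<open>v\<close> is adjacent to every
  other vertex, so the graph is a star and the labelling exists outright.\<close>

lemma star_minimal:
  assumes v: "v \<in> V" and "card {u \<in> V. d v u = 1} = \<Delta>" and card: "card V = Suc \<Delta>"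
  shows "recip_sum {..<Suc \<Delta>} (broom_dist \<Delta>) \<le> recip_sum V d"
    "\<exists>f. broom_labelling V d (Suc \<Delta>) \<Delta> f"
proof -
  have "{u \<in> V. d v u = 1} = V - {v}"
    using assms finite_V dist_self by (intro card_subset_eq) auto
  then have centre: "d v u = 1" "d u v = 1" if "u \<in> V" "u \<noteq> v" for u
    using that v dist_commute[of u v] by auto
  have "card (V - {v}) = card {1..\<Delta>}" using assms finite_V by simp
  then obtain g where g: "bij_betw g (V - {v}) {1..\<Delta>}"
    using finite_V by (meson finite_Diff finite_atLeastAtMost finite_same_card_bij)
  define f where "f = g(v := 0)"
  have "bij_betw f (V - {v}) {1..\<Delta>}"
    using g by (subst bij_betw_cong[of _ _ g]) (auto simp: f_def)
  moreover have "bij_betw f {v} {0}" by (simp add: f_def bij_betw_def)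
  ultimately have "bij_betw f (V - {v} \<union> {v}) ({1..\<Delta>} \<union> {0})" by (rule bij_betw_combine) auto
  moreover have "V - {v} \<union> {v} = V" "{1..\<Delta>} \<union> {0} = {..<Suc \<Delta>}" using v by auto
  ultimately have f: "bij_betw f V {..<Suc \<Delta>}" by simp
  have fv: "f x = 0 \<longleftrightarrow> x = v" if "x \<in> V" for x
    using f v that by (metis bij_betw_imp_inj_on f_def fun_upd_same inj_onD)
  have f_less: "f x < Suc \<Delta>" if "x \<in> V" for x using f that bij_betwE by fastforce
  have f_eq: "f x = f y \<longleftrightarrow> x = y" if "x \<in> V" "y \<in> V" for x y
    using f that by (metis bij_betw_imp_inj_on inj_onD)
  \<comment> \<open>Two neighbours of \<open>v\<close> are equally far from \<open>v\<close>, hence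
    not adjacent by \<open>adjacent_dist_neq\<close>.\<close>
  have adj: "d x y = 1 \<longleftrightarrow> x \<noteq> y \<and> (x = v \<or> y = v)" if "x \<in> V" "y \<in> V" for x y
  proof
    assume "d x y = 1"
    then show "x \<noteq> y \<and> (x = v \<or> y = v)"
      using that dist_self[of x] adjacent_dist_neq[of x y v] v centre(2)[of x] centre(2)[of y]
      by (cases "x = v") auto
  next
    assume "x \<noteq> y \<and> (x = v \<or> y = v)"
    then show "d x y = 1" using that centre by blast
  qed
  have "broom_labelling V d (Suc \<Delta>) \<Delta> f"
    unfolding broom_labelling_def
  proof (intro conjI ballI f)
    fix x y assume xy: "x \<in> V" "y \<in> V"
    have "(f x, f y) \<in> parcs (broom (Suc \<Delta>) \<Delta>) \<longleftrightarrow> f x \<noteq> f y \<and> (f x = 0 \<or> f y = 0)"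
      by (rule parcs_star_broom_iff[OF f_less[OF xy(1)] f_less[OF xy(2)]])
    then show "d x y = 1 \<longleftrightarrow> (f x, f y) \<in> parcs (broom (Suc \<Delta>) \<Delta>)"
      using adj[OF xy] f_eq[OF xy] fv xy by simp
  qed
  then show "\<exists>f. broom_labelling V d (Suc \<Delta>) \<Delta> f" by blast
  \<comment> \<open>A detour through \<open>v\<close> bounds each distance by the one in the star;
    on the diagonal the left side is \<open>1 / 0 = 0\<close>.\<close>
  have le: "1 / real (broom_dist \<Delta> (f x) (f y)) \<le> 1 / real (d x y)" if xy: "x \<in> V" "y \<in> V" for x y
  proof (cases "x = y")
    case False
    have "0 < d x y" using False xy dist_eq_0 by blast
    moreover have "d x y \<le> d x v + d v y" using dist_triangle xy v by blast
    then have "d x y \<le> broom_dist \<Delta> (f x) (f y)"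
      using False xy v fv[of x] fv[of y] f_eq[OF xy] centre[of x] centre[of y] dist_self[OF v]
        f_less[of x] f_less[of y]
      by (auto simp: broom_dist_def)
    ultimately show ?thesis by (simp add: frac_le)
  qed (simp add: broom_dist_def)
  have "recip_sum {..<Suc \<Delta>} (broom_dist \<Delta>) = recip_sum V (\<lambda>x y. broom_dist \<Delta> (f x) (f y))"
    using recip_sum_reindex[OF f, of "\<lambda>x y. broom_dist \<Delta> (f x) (f y)" "broom_dist \<Delta>"] by simp
  also have "\<dots> \<le> recip_sum V d" unfolding recip_sum_def by (intro sum_mono le)
  finally show "recip_sum {..<Suc \<Delta>} (broom_dist \<Delta>) \<le> recip_sum V d" .
qed

end

text \<open>The induction keeps \<open>d\<close> and \<open>v\<close> fixed and shrinks only
  \<open>V\<close>; \<open>\<Delta>\<close> is tied to \<open>v\<close> alone, so it survives the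
  removal of a vertex not adjacent to \<open>v\<close>.\<close>

lemma broom_minimal:
  assumes "tree_metric V d" "v \<in> V" "card {u \<in> V. d v u = 1} = \<Delta>" "card V = n" "2 \<le> \<Delta>"
  shows "recip_sum {..<n} (broom_dist \<Delta>) \<le> recip_sum V d \<and>
    (recip_sum V d = recip_sum {..<n} (broom_dist \<Delta>) \<longrightarrow> (\<exists>f. broom_labelling V d n \<Delta> f))"
  using assms
proof (induction n arbitrary: V)
  case 0
  then show ?case using tree_metric.finite_V by fastforce
next
  case (Suc n)
  interpret tree_metric V d by fact
  note v = Suc.prems(2) and deg = Suc.prems(3) and cardV = Suc.prems(4)
  have "{u \<in> V. d v u = 1} \<subseteq> V - {v}" using dist_self v by auto
  then have "card {u \<in> V. d v u = 1} \<le> card (V - {v})" using finite_V by (intro card_mono) auto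
  then have "\<Delta> \<le> n" using deg cardV v finite_V by simp
  show ?case
  proof (cases "n = \<Delta>")
    case True
    then show ?thesis using star_minimal[OF v deg] cardV by auto
  next
    case False
    then have "\<Delta> < n" using \<open>\<Delta> \<le> n\<close> by simp
    have "Max (d v ` V) \<in> d v ` V" using finite_V v by (intro Max_in) auto
    then obtain w where w: "w \<in> V" "d v w = Max (d v ` V)" by auto
    have far: "d v u \<le> d v w" if "u \<in> V" for u using that finite_V w by simp
    \<comment> \<open>Otherwise all \<open>n\<close> vertices other than \<open>v\<close> would be
      its neighbours, against \<open>\<Delta> < n\<close>.\<close>
    have "1 < d v w"
    proof (rule ccontr)
      assume "\<not> 1 < d v w"
      then have "d v u \<le> 1" if "u \<in> V" for u using far[OF that] by simp
      then have "V - {v} \<subseteq> {u \<in> V. d v u = 1}"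
        using dist_eq_0[OF v] by (auto simp: le_Suc_eq)
      then have "card (V - {v}) \<le> card {u \<in> V. d v u = 1}" using finite_V by (intro card_mono) auto
      then show False using deg cardV v finite_V \<open>\<Delta> < n\<close> by simp
    qed
    then have "v \<noteq> w" using dist_self v by force
    have nbrs: "{u \<in> V - {w}. d v u = 1} = {u \<in> V. d v u = 1}" using \<open>1 < d v w\<close> by auto
    have IH: "recip_sum {..<n} (broom_dist \<Delta>) \<le> recip_sum (V - {w}) d"
      using Suc.IH[of "V - {w}"] remove_farthest[OF v w(1) \<open>v \<noteq> w\<close> far] Suc.prems nbrs w v
        \<open>v \<noteq> w\<close> finite_V by simp
    have split: "recip_sum V d = recip_sum (V - {w}) d + 2 * (\<Sum>u\<in>V - {w}. 1 / real (d w u))"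
      using recip_sum_insert[of "V - {w}" w d] finite_V w dist_self dist_commute
      by (simp add: insert_absorb)
    define b where "b = (\<Sum>i=1..n + 2 - \<Delta>. 1 / real i) + real (\<Delta> - 2) / real (n + 2 - \<Delta>)"
    note bound = transmission_lower_bound[OF v w(1) \<open>v \<noteq> w\<close>, unfolded deg cardV, OF Suc.prems(5)]
    have m: "Suc n + 1 - \<Delta> = n + 2 - \<Delta>" by simp
    have b: "b \<le> (\<Sum>u\<in>V - {w}. 1 / real (d w u))" using bound(1) unfolding m b_def .
    note broom_eq = recip_sum_broom_Suc[OF Suc.prems(5) \<open>\<Delta> < n\<close>, folded b_def]
    have "\<exists>f. broom_labelling V d (Suc n) \<Delta> f"
      if "recip_sum V d = recip_sum {..<Suc n} (broom_dist \<Delta>)"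
    proof -
      \<comment> \<open>Equality of the totals makes both summands tight. The labelling is then
        built afresh from the layers around \<open>w\<close>, not extended from
        \<open>V - {w}\<close>.\<close>
      have "(\<Sum>u\<in>V - {w}. 1 / real (d w u)) = b"
        using that IH b unfolding split broom_eq by linarith
      then have layers: "d w ` V = {0..Suc n + 1 - \<Delta>}"
        "inj_on (d w) {u \<in> V. d w u < Suc n + 1 - \<Delta>}"
        using bound(2) unfolding m b_def by auto
      have "\<Delta> < Suc n" using \<open>\<Delta> < n\<close> by simp
      note bl = broom_layer_image[OF Suc.prems(5) this]
      obtain f where f: "bij_betw f V {..<Suc n}" "\<forall>x\<in>V. broom_layer (Suc n) \<Delta> (f x) = d w x"
        using layered_bij[OF finite_V _ _ layers(1) bl(1) layers(2) bl(2)] cardV by auto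
      have "d w x \<le> Suc n + 1 - \<Delta>" if "x \<in> V" for x using layers(1) that by auto
      note adj = adjacent_iff_layers[OF w(1) this layers(2)]
      have "d x y = 1 \<longleftrightarrow> (f x, f y) \<in> parcs (broom (Suc n) \<Delta>)" if "x \<in> V" "y \<in> V" for x y
        using that f bij_betwE[OF f(1)] Suc.prems(5) \<open>\<Delta> < Suc n\<close>
        by (subst parcs_broom_iff_layers) (auto simp del: One_nat_def simp: adj)
      then show ?thesis using f(1) unfolding broom_labelling_def by blast
    qed
    then show ?thesis using IH b unfolding split broom_eq by auto
  qed
qed

section \<open>Graph distance and isomorphism\<close>

text \<open>A certificate for distances to \<open>y\<close>: \<open>lip\<close> makes
  \<open>d\<close> a lower bound for the length of any walk to \<open>y\<close>, and following
  \<open>step\<close> down to \<open>y\<close> produces a walk attaining it.\<close>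

lemma graph_dist_eqI:
  fixes d :: "'a \<Rightarrow> 'a \<Rightarrow> nat"
  assumes "pair_wf_digraph G" and y: "y \<in> pverts G" and x: "x \<in> pverts G"
    and self: "d y y = 0"
    and lip: "\<And>x z. (x, z) \<in> parcs G \<Longrightarrow> d x y \<le> Suc (d z y)"
    and step: "\<And>x. x \<in> pverts G \<Longrightarrow> x \<noteq> y \<Longrightarrow> \<exists>z. (x, z) \<in> parcs G \<and> d x y = Suc (d z y)"
  shows "graph_dist G x y = real (d x y)"
proof -
  interpret pair_wf_digraph G by fact
  have cost: "awalk_cost (\<lambda>_. 1) p = real (length p)" for p
    by (induction p) auto
  have le: "d u y \<le> length p" if "awalk u p y" for u p
    using that
  proof (induction p arbitrary: u)
    case Nil
    then show ?case using self by (simp add: awalk_Nil_iff)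
  next
    case (Cons e p)
    then have "(u, snd e) \<in> parcs G" "awalk (snd e) p y"
      by (auto simp: awalk_Cons_iff)
    then show ?case using Cons.IH lip by fastforce
  qed
  have ex: "\<exists>p. awalk u p y \<and> length p = d u y" if "u \<in> pverts G" for u
    using that
  proof (induction "d u y" arbitrary: u rule: less_induct)
    case less
    show ?case
    proof (cases "u = y")
      case True
      then show ?thesis using y self by (intro exI[of _ "[]"]) (simp add: awalk_Nil_iff)
    next
      case False
      then obtain z where z: "(u, z) \<in> parcs G" "d u y = Suc (d z y)" using step less by blast
      then obtain p where "awalk z p y" "length p = d z y"
        using less.hyps[of z] in_arcsD2 by auto
      then show ?thesis using z in_arcsD1
        by (intro exI[of _ "(u, z) # p"]) (auto simp: awalk_Cons_iff)
    qed
  qed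
  obtain p where p: "awalk x p y" "length p = d x y" using ex x by blast
  have "\<mu> (\<lambda>_. 1) x y = ereal (real (d x y))"
    unfolding \<mu>_def
  proof (rule INF_eqI)
    fix i assume "i \<in> {p. awalk x p y}"
    then show "ereal (real (d x y)) \<le> ereal (awalk_cost (\<lambda>_. 1) i)" using le by (simp add: cost)
  next
    fix b assume "\<And>i. i \<in> {p. awalk x p y} \<Longrightarrow> b \<le> ereal (awalk_cost (\<lambda>_. 1) i)"
    then show "b \<le> ereal (real (d x y))" using p cost by fastforce
  qed
  then show ?thesis by (simp add: graph_dist_def)
qed

lemma harary_index_eq:
  assumes "pair_graph G"
    and self: "\<And>x. x \<in> pverts G \<Longrightarrow> d x x = 0"
    and lip: "\<And>x y z. (x, z) \<in> parcs G \<Longrightarrow> y \<in> pverts G \<Longrightarrow> d x y \<le> Suc (d z y)"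
    and step: "\<And>x y. x \<in> pverts G \<Longrightarrow> y \<in> pverts G \<Longrightarrow> x \<noteq> y \<Longrightarrow>
      \<exists>z. (x, z) \<in> parcs G \<and> d x y = Suc (d z y)"
  shows "harary_index G = recip_sum (pverts G) d / 2"
proof -
  interpret pair_graph G by fact
  have d: "graph_dist G x y = real (d x y)" if "x \<in> pverts G" "y \<in> pverts G" for x y
    using that self lip step by (intro graph_dist_eqI pair_wf_digraph) auto
  \<comment> \<open>The symmetry needed for unordered pairs is inherited from
    \<open>graph_dist\<close>.\<close>
  have "d x y = d y x" if "x \<in> pverts G" "y \<in> pverts G" for x y
    using d[of x y] d[of y x] graph_dist_commute[OF assms(1), of x y] that by simp
  then show ?thesis
    unfolding harary_index_def
    using pair_finite_verts self d by (intro sum_pairs_eq_recip_sum) (auto simp: pair_dist_eq[OF assms(1)])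
qed

lemma broom_dist_triangle: "broom_dist \<Delta> a b \<le> broom_dist \<Delta> a c + broom_dist \<Delta> c b"
proof -
  \<comment> \<open>\<open>D\<close> is the distance between path positions and \<open>l\<close> the
    extra edge at a leaf; an intermediate leaf \<open>c\<close> only adds to the right side.\<close>
  define D :: "nat \<Rightarrow> nat \<Rightarrow> nat" where "D p q = (p - q) + (q - p)" for p q
  define l :: "nat \<Rightarrow> nat" where "l x = of_bool (0 < x \<and> x < \<Delta>)" for x
  have eq: "broom_dist \<Delta> x y = (if x = y then 0 else l x + l y + D (Suc x - \<Delta>) (Suc y - \<Delta>))" for x y
    by (simp add: broom_dist_def D_def l_def)
  have "D p q \<le> D p r + D r q" for p q r
    unfolding D_def by arith
  from this[of "Suc a - \<Delta>" "Suc b - \<Delta>" "Suc c - \<Delta>"] show ?thesis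
    unfolding eq by auto
qed

lemma broom_dist_adjacent:
  assumes "\<Delta> < n" "0 < \<Delta>" "(a, c) \<in> parcs (broom n \<Delta>)"
  shows "broom_dist \<Delta> a c = 1"
proof -
  consider "a = 0" "1 \<le> c" "c \<le> \<Delta>" | "c = 0" "1 \<le> a" "a \<le> \<Delta>" | "\<Delta> \<le> a" "c = Suc a" | "\<Delta> \<le> c" "a = Suc c"
    using assms(3) unfolding parcs_broom_iff[OF assms(1)] by blast
  then show ?thesis
  proof cases
    case 1 then show ?thesis by (cases "c = \<Delta>") (auto simp: broom_dist_def)
  next
    case 2 then show ?thesis by (cases "a = \<Delta>") (auto simp: broom_dist_def)
  next
    case 3 then show ?thesis using assms(2) by (auto simp: broom_dist_def)
  next
    case 4 then show ?thesis using assms(2) by (auto simp: broom_dist_def)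
  qed
qed

lemma broom_dist_step:
  assumes "\<Delta> < n" "0 < \<Delta>" "a < n" "b < n" "a \<noteq> b"
  shows "\<exists>z. (a, z) \<in> parcs (broom n \<Delta>) \<and> broom_dist \<Delta> a b = Suc (broom_dist \<Delta> z b)"
proof -
  \<comment> \<open>The witness is always the next vertex on the way to \<open>b\<close>: a leaf
    steps to the centre, the centre to the leaf \<open>b\<close> or to \<open>\<Delta>\<close>, and
    a path vertex outwards or inwards, with \<open>0\<close> following
    \<open>\<Delta>\<close>.\<close>
  consider "0 < a" "a < \<Delta>" | "a = 0" "b < \<Delta>" | "a = 0" "\<Delta> \<le> b" | "\<Delta> \<le> a" "a < b"
    | "a = \<Delta>" "b < a" | "\<Delta> < a" "b < a"
    using assms by linarith
  then show ?thesis
  proof cases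
    case 1
    then show ?thesis
      using assms by (intro exI[of _ 0]) (auto simp: parcs_broom_iff broom_dist_def)
  next
    case 2
    then show ?thesis
      using assms by (intro exI[of _ b]) (auto simp: parcs_broom_iff broom_dist_def)
  next
    case 3
    then show ?thesis
      using assms by (intro exI[of _ \<Delta>]) (auto simp: parcs_broom_iff broom_dist_def)
  next
    case 4
    then show ?thesis
      using assms by (intro exI[of _ "Suc a"]) (auto simp: parcs_broom_iff broom_dist_def)
  next
    case 5
    then show ?thesis
      using assms by (intro exI[of _ 0]) (auto simp: parcs_broom_iff broom_dist_def)
  next
    case 6
    then have "(a, a - 1) \<in> parcs (broom n \<Delta>)" using assms by (auto simp: parcs_broom_iff)
    moreover have "broom_dist \<Delta> a b = Suc (broom_dist \<Delta> (a - 1) b)"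
      using 6 assms by (cases "b = a - 1"; cases "b < \<Delta>") (auto simp: broom_dist_def)
    ultimately show ?thesis by blast
  qed
qed

text \<open>Taking \<open>f\<close> to be the identity of the broom evaluates its index; taking an isomorphism
  transports that value, so invariance under isomorphism needs no separate proof.\<close>

lemma harary_index_broom_labelling:
  assumes "pair_graph G" "\<Delta> < n" "0 < \<Delta> \<or> n = 1" and f: "bij_betw f (pverts G) {..<n}"
    and arcs: "\<And>x y. x \<in> pverts G \<Longrightarrow> y \<in> pverts G \<Longrightarrow>
      (x, y) \<in> parcs G \<longleftrightarrow> (f x, f y) \<in> parcs (broom n \<Delta>)"
  shows "harary_index G = recip_sum {..<n} (broom_dist \<Delta>) / 2"
proof -
  interpret pair_graph G by fact
  have less: "f x < n" if "x \<in> pverts G" for x using f that bij_betwE by blast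
  have "harary_index G = recip_sum (pverts G) (\<lambda>x y. broom_dist \<Delta> (f x) (f y)) / 2"
  proof (rule harary_index_eq[OF assms(1)])
    fix x y z assume xz: "(x, z) \<in> parcs G"
    then have V: "x \<in> pverts G" "z \<in> pverts G" using in_arcsD1 in_arcsD2 by blast+
    then have xz': "(f x, f z) \<in> parcs (broom n \<Delta>)" using arcs xz by blast
    \<comment> \<open>The one-vertex broom has no arcs.\<close>
    then have "0 < \<Delta>" using assms(2,3) by (auto simp: parcs_broom_iff)
    then show "broom_dist \<Delta> (f x) (f y) \<le> Suc (broom_dist \<Delta> (f z) (f y))"
      using broom_dist_triangle[of \<Delta> "f x" "f y" "f z"] broom_dist_adjacent[OF assms(2) _ xz'] by simp
  next
    fix x y assume xy: "x \<in> pverts G" "y \<in> pverts G" "x \<noteq> y"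
    then have "f x \<noteq> f y" using f by (auto simp: bij_betw_def dest: inj_onD)
    then obtain c where c: "(f x, c) \<in> parcs (broom n \<Delta>)"
      "broom_dist \<Delta> (f x) (f y) = Suc (broom_dist \<Delta> c (f y))"
      using broom_dist_step[OF assms(2) _ less[OF xy(1)] less[OF xy(2)]] assms(3)
        less[OF xy(1)] less[OF xy(2)] by auto
    then have "c < n" using assms(2) by (simp add: parcs_broom_iff)
    then have "c \<in> f ` pverts G" using f by (simp add: bij_betw_def)
    then obtain z where "z \<in> pverts G" "c = f z" by blast
    then show "\<exists>z. (x, z) \<in> parcs G \<and>
        broom_dist \<Delta> (f x) (f y) = Suc (broom_dist \<Delta> (f z) (f y))"
      using c arcs xy by blast
  qed (simp add: broom_dist_def)
  also have "recip_sum (pverts G) (\<lambda>x y. broom_dist \<Delta> (f x) (f y)) = recip_sum {..<n} (broom_dist \<Delta>)"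
    by (rule recip_sum_reindex[OF f]) simp
  finally show ?thesis .
qed

text \<open>A digraph isomorphism also carries an arc map, but arcs here are pairs with projections
  as tail and head, so on arcs it must be \<open>map_prod f f\<close> for the vertex map
  \<open>f\<close>.\<close>

lemma digraph_iso_with_proj_iff:
  assumes "pair_wf_digraph G" "pair_wf_digraph H"
  shows "digraph_iso (with_proj G) (with_proj H) \<longleftrightarrow>
    (\<exists>f. bij_betw f (pverts G) (pverts H) \<and>
      (\<forall>x\<in>pverts G. \<forall>y\<in>pverts G. (x, y) \<in> parcs G \<longleftrightarrow> (f x, f y) \<in> parcs H))"
    (is "?L \<longleftrightarrow> ?R")
proof
  interpret G: pair_wf_digraph G by fact
  interpret H: pair_wf_digraph H by fact
  assume ?L
  then obtain h where h: "pre_digraph.digraph_isomorphism (with_proj G) h"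
    and H: "with_proj H = app_iso h (with_proj G)"
    unfolding digraph_iso_def by blast
  let ?f = "iso_verts h"
  have inj: "inj_on ?f (pverts G)"
    using h by (simp add: pre_digraph.digraph_isomorphism_def)
  have V: "pverts H = ?f ` pverts G" and A: "parcs H = iso_arcs h ` parcs G"
    and "iso_tail h = fst" "iso_head h = snd"
    using arg_cong[OF H, of verts] arg_cong[OF H, of arcs] arg_cong[OF H, of tail]
      arg_cong[OF H, of head] by auto
  then have arc: "iso_arcs h a = (?f (fst a), ?f (snd a))" if "a \<in> parcs G" for a
    using h that by (auto simp: pre_digraph.digraph_isomorphism_def prod_eq_iff)
  have "(x, y) \<in> parcs G \<longleftrightarrow> (?f x, ?f y) \<in> parcs H" if "x \<in> pverts G" "y \<in> pverts G" for x y
  proof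
    assume "(x, y) \<in> parcs G"
    then show "(?f x, ?f y) \<in> parcs H" using arc A by force
  next
    assume "(?f x, ?f y) \<in> parcs H"
    then obtain a where a: "a \<in> parcs G" "?f (fst a) = ?f x" "?f (snd a) = ?f y"
      using arc A by auto
    then have "fst a = x" "snd a = y"
      using inj that G.arc_fst_in_verts G.arc_snd_in_verts by (auto dest: inj_onD)
    then show "(x, y) \<in> parcs G" using a(1) by auto
  qed
  then show ?R using inj V by (auto simp: bij_betw_def)
next
  interpret G: pair_wf_digraph G by fact
  interpret H: pair_wf_digraph H by fact
  assume ?R
  then obtain f where f: "bij_betw f (pverts G) (pverts H)"
    and arc: "\<And>x y. x \<in> pverts G \<Longrightarrow> y \<in> pverts G \<Longrightarrow> (x, y) \<in> parcs G \<longleftrightarrow> (f x, f y) \<in> parcs H"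
    by blast
  define h where "h = \<lparr>iso_verts = f, iso_arcs = map_prod f f, iso_head = snd, iso_tail = fst\<rparr>"
  have inj: "inj_on f (pverts G)" and V: "f ` pverts G = pverts H"
    using f by (auto simp: bij_betw_def)
  have sub: "parcs G \<subseteq> pverts G \<times> pverts G" using G.in_arcsD1 G.in_arcsD2 by auto
  have "map_prod f f ` parcs G = parcs H"
  proof (intro equalityI subsetI)
    fix a assume "a \<in> map_prod f f ` parcs G"
    then show "a \<in> parcs H" using arc sub by auto
  next
    fix a assume a: "a \<in> parcs H"
    then have "fst a \<in> f ` pverts G" "snd a \<in> f ` pverts G"
      using V H.arc_fst_in_verts H.arc_snd_in_verts by auto
    then obtain x y where "x \<in> pverts G" "y \<in> pverts G" "a = (f x, f y)"
      by (metis imageE prod.collapse)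
    then show "a \<in> map_prod f f ` parcs G" using a arc by (intro image_eqI[of _ _ "(x, y)"]) auto
  qed
  then have "with_proj H = app_iso h (with_proj G)"
    unfolding app_iso_def by (simp add: with_proj_def h_def V)
  moreover have "pre_digraph.digraph_isomorphism (with_proj G) h"
    unfolding pre_digraph.digraph_isomorphism_def
    using G.wf_digraph_axioms inj inj_on_subset[OF map_prod_inj_on[OF inj inj] sub] by (simp add: h_def)
  ultimately show ?L unfolding digraph_iso_def by blast
qed

section \<open>Walks in trees\<close>

context pair_graph
begin

text \<open>A distance with natural values, unlike \<open>graph_dist\<close>;
  \<open>harary_index_eq\<close> later connects it to the index.\<close>

definition walk_dist :: "'a \<Rightarrow> 'a \<Rightarrow> nat" where
  "walk_dist u v = (LEAST k. \<exists>p. awalk u p v \<and> length p = k)"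

lemma walk_dist_le: "awalk u p v \<Longrightarrow> walk_dist u v \<le> length p"
  unfolding walk_dist_def by (rule Least_le) blast

lemma shortest_walk:
  assumes "u \<rightarrow>\<^sup>*\<^bsub>with_proj G\<^esub> v"
  shows "\<exists>p. awalk u p v \<and> length p = walk_dist u v"
proof -
  obtain p where "awalk u p v" using assms reachable_awalk by auto
  then have "\<exists>k. \<exists>p. awalk u p v \<and> length p = k" by blast
  then show ?thesis unfolding walk_dist_def by (rule LeastI_ex)
qed

text \<open>Shorten \<open>q\<close> to a path, nonempty since \<open>z \<noteq> z'\<close>, and
  close it through \<open>x\<close>; the two arcs at \<open>x\<close> bring the length to at least
  3.\<close>

lemma cycle_through_vertex:
  assumes "(x, z) \<in> parcs G" "(z', x) \<in> parcs G" "z \<noteq> z'"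
    and q: "awalk z q z'" "x \<notin> set (awalk_verts z q)"
  shows "\<exists>p. cycle p \<and> 3 \<le> length p"
proof -
  define p where "p = awalk_to_apath q"
  have p: "apath z p z'" unfolding p_def by (rule apath_awalk_to_apath[OF q(1)])
  then have aw: "awalk z p z'" by (rule awalkI_apath)
  have "p \<noteq> []" using p assms(3) by (auto simp: apath_Nil_iff)
  have "set p \<subseteq> set q" unfolding p_def by (rule awalk_to_apath_subset[OF q(1)])
  then have "set (awalk_verts z p) \<subseteq> set (awalk_verts z q)"
    unfolding set_awalk_verts[OF aw] set_awalk_verts[OF q(1)] using \<open>p \<noteq> []\<close> by auto
  then have x: "x \<notin> set (awalk_verts z p)" using q(2) by blast
  let ?c = "(x, z) # p @ [(z', x)]"
  have "awalk x ?c x"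
    using assms(1,2) aw in_arcsD1 in_arcsD2 by (auto simp: awalk_Cons_iff awalk_Nil_iff)
  moreover have "tl (awalk_verts x ?c) = awalk_verts z p @ [x]"
    using aw assms(2) in_arcsD1 in_arcsD2
    by (simp, subst awalk_verts_append[where u = z and v = x]) (auto simp: awalk_Cons_iff awalk_Nil_iff)
  moreover have "distinct (awalk_verts z p @ [x])"
    using p x by (simp add: apath_def)
  ultimately have "cycle ?c" unfolding cycle_def by force
  moreover have "3 \<le> length ?c" using \<open>p \<noteq> []\<close> by (cases p) auto
  ultimately show ?thesis by blast
qed

text \<open>A visit to \<open>x\<close> would come after at least one arc, leaving a walk from
  \<open>x\<close> to \<open>y\<close> shorter than their distance.\<close>

lemma shortest_walk_avoids:
  assumes p: "awalk z p y" "length p \<le> walk_dist x y" and "x \<noteq> z"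
  shows "x \<notin> set (awalk_verts z p)"
proof
  assume "x \<in> set (awalk_verts z p)"
  then obtain q r where qr: "p = q @ r" "awalk z q x" "awalk x r y"
    using awalk_decomp[OF p(1)] by blast
  then have "q \<noteq> []" using \<open>x \<noteq> z\<close> by (auto simp: awalk_Nil_iff)
  then show False using walk_dist_le[OF qr(3)] p(2) qr(1) by (cases q) auto
qed

lemma tree_metric_walk_dist:
  assumes conn: "\<And>u v. u \<in> pverts G \<Longrightarrow> v \<in> pverts G \<Longrightarrow> u \<rightarrow>\<^sup>*\<^bsub>with_proj G\<^esub> v"
    and acyc: "\<nexists>p. cycle p \<and> 3 \<le> length p"
  shows "tree_metric (pverts G) walk_dist"
    and "\<And>x y. x \<in> pverts G \<Longrightarrow> y \<in> pverts G \<Longrightarrow> walk_dist x y = 1 \<longleftrightarrow> (x, y) \<in> parcs G"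
proof -
  have walk: "\<exists>p. awalk u p v \<and> length p = walk_dist u v" if "u \<in> pverts G" "v \<in> pverts G" for u v
    using shortest_walk conn that by blast
  have zero: "walk_dist x y = 0 \<longleftrightarrow> x = y" if xy: "x \<in> pverts G" "y \<in> pverts G" for x y
  proof
    assume "walk_dist x y = 0"
    then show "x = y" using walk[OF xy] by (auto simp: awalk_Nil_iff)
  next
    assume "x = y"
    then show "walk_dist x y = 0" using walk_dist_le[of x "[]" y] xy by (simp add: awalk_Nil_iff)
  qed
  have adj1: "walk_dist x y = 1" if "(x, y) \<in> parcs G" for x y
  proof -
    have "x \<in> pverts G" "y \<in> pverts G" "x \<noteq> y" using that in_arcsD1 in_arcsD2 no_loops' by blast+
    moreover have "awalk x [(x, y)] y" using that in_arcsD1 in_arcsD2 by (auto simp: awalk_Cons_iff awalk_Nil_iff)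
    ultimately show ?thesis using walk_dist_le[of x "[(x, y)]" y] zero[of x y] by simp
  qed
  show adj: "walk_dist x y = 1 \<longleftrightarrow> (x, y) \<in> parcs G" if xy: "x \<in> pverts G" "y \<in> pverts G" for x y
  proof
    assume "walk_dist x y = 1"
    then obtain p where "awalk x p y" "length p = 1" using walk[OF xy] by auto
    then show "(x, y) \<in> parcs G"
      by (auto simp: length_Suc_conv awalk_Cons_iff awalk_Nil_iff)
  qed (rule adj1)
  have sym_le: "walk_dist y x \<le> walk_dist x y" if xy: "x \<in> pverts G" "y \<in> pverts G" for x y
  proof -
    obtain p where p: "awalk x p y" "length p = walk_dist x y" using walk[OF xy] by blast
    have "length (rev_path p) = length p" by (induction p) auto
    then show ?thesis using walk_dist_le[of y "rev_path p" x] p by simp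
  qed
  have tri: "walk_dist x z \<le> walk_dist x y + walk_dist y z"
    if xyz: "x \<in> pverts G" "y \<in> pverts G" "z \<in> pverts G" for x y z
  proof -
    obtain p q where pq: "awalk x p y" "length p = walk_dist x y" "awalk y q z" "length q = walk_dist y z"
      using walk xyz by metis
    then show ?thesis using walk_dist_le[OF awalk_appendI[OF pq(1,3)]] by simp
  qed
  show "tree_metric (pverts G) walk_dist"
  proof
    show "finite (pverts G)" by (rule pair_finite_verts)
  next
    fix x y assume xy: "x \<in> pverts G" "y \<in> pverts G"
    show "walk_dist x y = walk_dist y x" using sym_le xy by (intro antisym)
  next
    fix x y assume xy: "x \<in> pverts G" "y \<in> pverts G" "x \<noteq> y"
    obtain p where p: "awalk x p y" "length p = walk_dist x y" using walk xy by blast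
    then obtain e q where "p = e # q" using xy by (cases p) (auto simp: awalk_Nil_iff)
    then have arc: "(x, snd e) \<in> parcs G" and q: "awalk (snd e) q y" and len: "walk_dist x y = Suc (length q)"
      using p by (auto simp: awalk_Cons_iff)
    have V: "snd e \<in> pverts G" using arc in_arcsD2 by blast
    have "walk_dist x y \<le> Suc (walk_dist (snd e) y)" using tri[OF xy(1) V xy(2)] adj1[OF arc] by simp
    then show "\<exists>z\<in>pverts G. walk_dist x z = 1 \<and> walk_dist x y = Suc (walk_dist z y)"
      using V adj1[OF arc] walk_dist_le[OF q] len by (intro bexI[of _ "snd e"]) auto
  next
    fix x y z z' assume V: "x \<in> pverts G" "y \<in> pverts G" "z \<in> pverts G" "z' \<in> pverts G"
      and a: "walk_dist x z = 1" "walk_dist x z' = 1"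
      and le: "walk_dist z y \<le> walk_dist x y" "walk_dist z' y \<le> walk_dist x y"
    obtain p where p: "awalk z p y" "length p = walk_dist z y" using walk V by blast
    obtain p' where p': "awalk z' p' y" "length p' = walk_dist z' y" using walk V by blast
    have "x \<noteq> z" "x \<noteq> z'" using a zero V by fastforce+
    \<comment> \<open>If \<open>z\<close> and \<open>z'\<close> differed, shortest walks from both
      to \<open>y\<close> would join into a walk avoiding \<open>x\<close>, and closing it through
      \<open>x\<close> would give a forbidden cycle.\<close>
    have "x \<notin> set (awalk_verts z p)" "x \<notin> set (awalk_verts z' p')"
      using shortest_walk_avoids[OF p(1)] shortest_walk_avoids[OF p'(1)] p(2) p'(2) le
        \<open>x \<noteq> z\<close> \<open>x \<noteq> z'\<close> by auto
    moreover have "awalk y (rev_path p') z'" using p'(1) by simp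
    ultimately have q: "awalk z (p @ rev_path p') z'" "x \<notin> set (awalk_verts z (p @ rev_path p'))"
      using p(1) p'(1) awalk_verts_rev_path[OF p'(1)]
      by (auto simp: set_awalk_verts_append intro: awalk_appendI)
    have "(x, z) \<in> parcs G" "(z', x) \<in> parcs G" using a adj V arcs_symmetric by blast+
    then show "z = z'" using cycle_through_vertex[OF _ _ _ q] acyc by blast
  qed (use zero tri in auto)
qed

end

section \<open>From a tree to its walk metric, with the small degrees\<close>

theorem theorem3p10:
  fixes T :: "'a pair_pre_digraph" and n \<Delta> :: nat
  assumes "undirected_tree T"
    and "card (pverts T) = n"
    and "max_degree T = \<Delta>"
  shows "harary_index T \<ge> harary_index (broom n \<Delta>) \<and>
    (harary_index T = harary_index (broom n \<Delta>) \<longleftrightarrow>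
      digraph_iso (with_proj T) (with_proj (broom n \<Delta>)))"
proof -
  interpret pair_graph T using assms(1) by (simp add: undirected_tree_def)
  let ?d = walk_dist
  have sc: "strongly_connected (with_proj T)"
    using assms(1) symmetric_connected_imp_strongly_connected[OF pair_sym_arcs]
    by (simp add: undirected_tree_def)
  then have ne: "pverts T \<noteq> {}" by (simp add: strongly_connected_def)
  have conn: "u \<rightarrow>\<^sup>*\<^bsub>with_proj T\<^esub> v" if "u \<in> pverts T" "v \<in> pverts T" for u v
    using sc that by (simp add: strongly_connected_def)
  have acyc: "\<nexists>p. cycle p \<and> 3 \<le> length p" using assms(1) by (simp add: undirected_tree_def)
  interpret tree_metric "pverts T" ?d by (rule tree_metric_walk_dist(1)[OF conn acyc])
  note adj = tree_metric_walk_dist(2)[OF conn acyc]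
  have deg: "out_degree (with_proj T) v = card {u \<in> pverts T. ?d v u = 1}" if "v \<in> pverts T" for v
  proof -
    have "{u \<in> pverts T. ?d v u = 1} = snd ` out_arcs (with_proj T) v"
      using adj that in_arcsD2 by (force simp: out_arcs_def)
    moreover have "inj_on snd (out_arcs (with_proj T) v)"
      by (auto simp: inj_on_def out_arcs_def)
    ultimately show ?thesis by (simp add: out_degree_def card_image)
  qed
  have "\<Delta> \<in> out_degree (with_proj T) ` pverts T"
    using assms(3) ne pair_finite_verts unfolding max_degree_def by (metis Max_in finite_imageI image_is_empty)
  then obtain v where v: "v \<in> pverts T" "card {u \<in> pverts T. ?d v u = 1} = \<Delta>" using deg by auto
  have deg_le: "card {u \<in> pverts T. ?d x u = 1} \<le> \<Delta>" if "x \<in> pverts T" for x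
  proof -
    have "out_degree (with_proj T) x \<le> max_degree T"
      unfolding max_degree_def using that pair_finite_verts by (intro Max_ge) auto
    then show ?thesis using deg[OF that] assms(3) by simp
  qed
  have sub: "{u \<in> pverts T. ?d v u = 1} \<subseteq> pverts T - {v}" using dist_self v by auto
  then have "\<Delta> \<le> card (pverts T - {v})" using card_mono[OF _ sub] v(2) finite_V by simp
  then have "\<Delta> < n" using assms(2) v(1) finite_V card_gt_0_iff[of "pverts T"] by auto
  \<comment> \<open>Some \<open>w\<close> is neither \<open>v\<close> nor adjacent to it, so the
    first vertex \<open>z\<close> on the way to \<open>w\<close> has two neighbours. Hence degrees
    below 2 occur only when \<open>n = \<Delta> + 1\<close>, which \<open>star_minimal\<close>
    covers.\<close>
  have two: "2 \<le> \<Delta>" if "Suc \<Delta> < n"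
  proof -
    have "{u \<in> pverts T. ?d v u = 1} \<noteq> pverts T - {v}"
    proof
      assume "{u \<in> pverts T. ?d v u = 1} = pverts T - {v}"
      then show False using v assms(2) that finite_V by simp
    qed
    then obtain w where w: "w \<in> pverts T" "w \<noteq> v" "?d v w \<noteq> 1" using sub by auto
    then obtain z where z: "z \<in> pverts T" "?d v z = 1" "?d v w = Suc (?d z w)"
      using ex_step[OF v(1) w(1)] w(2) by blast
    then have "z \<noteq> w" using w by auto
    then obtain y where y: "y \<in> pverts T" "?d z y = 1" "?d z w = Suc (?d y w)"
      using ex_step[OF z(1) w(1)] by blast
    have "y \<noteq> v" using y z by auto
    moreover have "?d z v = 1" using z v dist_commute by simp
    ultimately have "{v, y} \<subseteq> {u \<in> pverts T. ?d z u = 1}" "card {v, y} = 2" using y v by auto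
    then have "2 \<le> card {u \<in> pverts T. ?d z u = 1}"
      using card_mono[of "{u \<in> pverts T. ?d z u = 1}" "{v, y}"] finite_V by simp
    then show ?thesis using deg_le[OF z(1)] by simp
  qed
  have pos: "0 < \<Delta> \<or> n = 1" using two \<open>\<Delta> < n\<close> by linarith
  have pgB: "pair_graph (broom n \<Delta>)" by (rule pair_graph_broom[OF \<open>\<Delta> < n\<close>])
  have H_T: "harary_index T = recip_sum (pverts T) ?d / 2"
  proof (rule harary_index_eq[OF pair_graph])
    fix x y z assume "(x, z) \<in> parcs T" "y \<in> pverts T"
    then show "?d x y \<le> Suc (?d z y)"
      using dist_triangle[of x z y] adj[of x z] in_arcsD1[of x z] in_arcsD2[of x z] by simp
  next
    fix x y assume "x \<in> pverts T" "y \<in> pverts T" "x \<noteq> y"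
    then show "\<exists>z. (x, z) \<in> parcs T \<and> ?d x y = Suc (?d z y)"
      using ex_step adj by meson
  qed (rule dist_self)
  have H_B: "harary_index (broom n \<Delta>) = recip_sum {..<n} (broom_dist \<Delta>) / 2"
    by (rule harary_index_broom_labelling[OF pgB \<open>\<Delta> < n\<close> pos, of id]) (auto simp: broom_def)
  have iso: "digraph_iso (with_proj T) (with_proj (broom n \<Delta>)) \<longleftrightarrow> (\<exists>f. broom_labelling (pverts T) ?d n \<Delta> f)"
    using digraph_iso_with_proj_iff[of T "broom n \<Delta>"] pair_wf_digraph adj pgB
    unfolding broom_labelling_def pair_graph_def pair_digraph_def pair_fin_digraph_def
    by (simp add: broom_def)
  have min: "recip_sum {..<n} (broom_dist \<Delta>) \<le> recip_sum (pverts T) ?d \<and>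
    (recip_sum (pverts T) ?d = recip_sum {..<n} (broom_dist \<Delta>) \<longrightarrow>
      (\<exists>f. broom_labelling (pverts T) ?d n \<Delta> f))"
  proof (cases "n = Suc \<Delta>")
    case True
    then show ?thesis using star_minimal[OF v] assms(2) by auto
  next
    case False
    then have "2 \<le> \<Delta>" using two \<open>\<Delta> < n\<close> by simp
    then show ?thesis using broom_minimal[OF tree_metric_axioms v assms(2)] by blast
  qed
  \<comment> \<open>The converse of the equality case: an isomorphic tree has the index of the
    broom.\<close>
  moreover have "recip_sum (pverts T) ?d = recip_sum {..<n} (broom_dist \<Delta>)"
    if "broom_labelling (pverts T) ?d n \<Delta> f" for f
    using harary_index_broom_labelling[OF pair_graph \<open>\<Delta> < n\<close> pos, of f] that adj H_T
    unfolding broom_labelling_def by auto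
  ultimately show ?thesis unfolding H_T H_B iso by auto
qed

end
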